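(* Let $\ell\in\frac12\mathbb{N}$ and let $p,q\in\{-\ell,-\ell+1,\dots,\ell\}$ with $q-p\le 0$ and $q+p\le 0$. For $n=0,\dots,\ell+q$ there are coefficients $c^\ell_n(p,q)\in\mathbb{Q}_{>0}$ such that for all $t$ $$\left(V^\ell(a_t)\right)_{p,q}=\sin^2(t)\sum_{n=0}^{\ell+q}c^\ell_n(p,q)\,U_{2\ell+p+q-2n}(\cos t),$$ and the coefficients are given by $$c^\ell_n(p,q)=\frac{2\ell+1}{\ell+p+1}\,\frac{(\ell-q)!(\ell+q)!}{(2\ell)!}\,\frac{(p-\ell)_{\ell+q-n}}{(\ell+p+2)_{\ell+q-n}}\,(-1)^{\ell+q-n}\,\frac{(2\ell+2-n)_n}{n!}.$$
   Context: $\mathbb{N}=\{0,1,2,\dots\}$. $(a)_k=a(a+1)\cdots(a+k-1)$, $(a)_0=1$. $U_k$ is the Chebyshev polynomial of the second kind of degree $k$. $K=\mathrm{SU}(2)$, $U=K\times K$. $m_t=\mathrm{diag}(e^{it/2},e^{-it/2})$, $a_t=(m_t,m_{-t})$, $A_*=\{a_t:0\le t<4\pi\}$. For $\ell\in\frac12\mathbb{N}$, $H^\ell=\mathbb{C}[x,y]_{2\ell}$ with $K$ acting by $T^\ell(k)p=p\circ k^t$ and orthonormal basis $\psi^\ell_j=\binom{2\ell}{\ell-j}^{1/2}x^{\ell-j}y^{\ell+j}$, $j=-\ell,\dots,\ell$; endomorphisms are written as matrices in this basis. For $(\ell_1,\ell_2)$ with $|\ell_1-\ell_2|\le\ell\le\ell_1+\ell_2$,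 $\ell_1+\ell_2-\ell\in\mathbb{Z}$, let $\beta^{\ell_1,\ell_2}_\ell:H^\ell\to H^{\ell_1}\otimes H^{\ell_2}$, $\psi^\ell_j\mapsto\sum_{j_1,j_2}C^{\ell_1,\ell_2,\ell}_{j_1,j_2,j}\psi^{\ell_1}_{j_1}\otimes\psi^{\ell_2}_{j_2}$ ($C$ = standard Clebsch-Gordan coefficients), and $\Phi^\ell_{\ell_1,\ell_2}(x)=(\beta^{\ell_1,\ell_2}_\ell)^*\circ T^{\ell_1,\ell_2}(x)\circ\beta^{\ell_1,\ell_2}_\ell$, with $T^{\ell_1,\ell_2}$ the outer tensor product representation of $U$. On $A_*$ it is diagonal with $(\Phi^\ell_{\ell_1,\ell_2}(a_t))_{j,j}=\sum_{j_1,j_2}e^{i(j_2-j_1)t}(C^{\ell_1,\ell_2,\ell}_{j_1,j_2,j})^2$. The full spherical function of degree $0$ is $(\Phi^\ell_0(a))_{p,q}=\left(\Phi^\ell_{\frac{\ell+p}{2},\frac{\ell-p}{2}}(a)\right)_{q,q}$, $p,q\in\{-\ell,\dots,\ell\}$, and the weight is $V^\ell(a_t)=\Phi^\ell_0(a_t)\left(\Phi^\ell_0(a_t)\right)^*\sin^2 t$. *)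

theory Defs
  imports "HOL-Analysis.Analysis" "HOL-Computational_Algebra.Polynomial"
begin

text \<open>Spins \<open>l\<close> and weights \<open>j\<close> are half-integers, represented as real numbers;
  \<open>2 * l \<in> \<nat>\<close> is assumed where needed. All exponents, factorials and binomial coefficients
  below have natural number arguments in the admissible range, where \<open>nat \<lfloor>x\<rfloor>\<close>
  is \<open>x\<close> itself.\<close>

definition weights :: "real \<Rightarrow> real set" where
  "weights l = (\<lambda>k. - l + real k) ` {..nat \<lfloor>2 * l\<rfloor>}"

definition rfact :: "real \<Rightarrow> real" where
  "rfact x = fact (nat \<lfloor>x\<rfloor>)"

fun chebyshev_U :: "nat \<Rightarrow> real poly" where
  "chebyshev_U 0 = 1"
| "chebyshev_U (Suc 0) = [:0, 2:]"
| "chebyshev_U (Suc (Suc n)) = [:0, 2:] * chebyshev_U (Suc n) - chebyshev_U n"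

subsection \<open>Spans of finite families of functions with a prescribed orthonormal basis\<close>

definition cspan :: "'i set \<Rightarrow> ('i \<Rightarrow> 'v \<Rightarrow> complex) \<Rightarrow> ('v \<Rightarrow> complex) set" where
  "cspan I e = {f. \<exists>c. f = (\<lambda>v. \<Sum>i\<in>I. c i * e i v)}"

text \<open>The coordinates of a function in the span of a linearly independent family
  \<open>(e i)\<close>, \<open>i \<in> I\<close>.\<close>

definition coords :: "'i set \<Rightarrow> ('i \<Rightarrow> 'v \<Rightarrow> complex) \<Rightarrow> ('v \<Rightarrow> complex) \<Rightarrow> 'i \<Rightarrow> complex" where
  "coords I e f = (THE c. (\<forall>i. i \<notin> I \<longrightarrow> c i = 0) \<and> f = (\<lambda>v. \<Sum>i\<in>I. c i * e i v))"

text \<open>The inner product, linear in the first argument, for which that family is orthonormal.\<close>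

definition cinner_basis ::
    "'i set \<Rightarrow> ('i \<Rightarrow> 'v \<Rightarrow> complex) \<Rightarrow> ('v \<Rightarrow> complex) \<Rightarrow> ('v \<Rightarrow> complex) \<Rightarrow> complex" where
  "cinner_basis I e f g = (\<Sum>i\<in>I. coords I e f i * cnj (coords I e g i))"

subsection \<open>The group and its representations\<close>

definition SU2 :: "(complex^2^2) set" where
  "SU2 = {k. k ** (\<chi> i j. cnj (k $ j $ i)) = mat 1 \<and> det k = 1}"

definition m_elt :: "real \<Rightarrow> complex^2^2" where
  "m_elt t = vector [vector [cis (t / 2), 0], vector [0, cis (- (t / 2))]]"

definition a_elt :: "real \<Rightarrow> (complex^2^2) \<times> (complex^2^2)" where
  "a_elt t = (m_elt t, m_elt (- t))"

lemma m_elt_in_SU2: "m_elt t \<in> SU2"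
  by (simp add: SU2_def m_elt_def det_2 vec_eq_iff forall_2 matrix_matrix_mult_def sum_2
      mat_def cis_cnj cis_mult)

lemma a_elt_in_SU2_times_SU2: "a_elt t \<in> SU2 \<times> SU2"
  by (simp add: a_elt_def m_elt_in_SU2)

text \<open>Polynomials in \<open>x, y\<close> are identified with the functions they induce on
  \<open>\<complex>\<^sup>2\<close>, with \<open>x = v $ 1\<close> and \<open>y = v $ 2\<close>.\<close>

definition Hspace :: "real \<Rightarrow> (complex^2 \<Rightarrow> complex) set" where
  "Hspace l = cspan {..nat \<lfloor>2 * l\<rfloor>} (\<lambda>k v. (v $ 1) ^ (nat \<lfloor>2 * l\<rfloor> - k) * (v $ 2) ^ k)"

definition psi :: "real \<Rightarrow> real \<Rightarrow> complex^2 \<Rightarrow> complex" where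
  "psi l j v = of_real (sqrt (real (nat \<lfloor>2 * l\<rfloor> choose nat \<lfloor>l - j\<rfloor>)))
     * (v $ 1) ^ nat \<lfloor>l - j\<rfloor> * (v $ 2) ^ nat \<lfloor>l + j\<rfloor>"

definition Hinner :: "real \<Rightarrow> (complex^2 \<Rightarrow> complex) \<Rightarrow> (complex^2 \<Rightarrow> complex) \<Rightarrow> complex" where
  "Hinner l = cinner_basis (weights l) (psi l)"

text \<open>The matrix of an endomorphism of \<open>H\<^sup>l\<close> in the basis \<open>psi l\<close>;
  \<open>i\<close> is the row and \<open>j\<close> the column.\<close>

definition mat_entry ::
    "real \<Rightarrow> ((complex^2 \<Rightarrow> complex) \<Rightarrow> (complex^2 \<Rightarrow> complex)) \<Rightarrow> real \<Rightarrow> real \<Rightarrow> complex" where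
  "mat_entry l A i j = coords (weights l) (psi l) (A (psi l j)) i"

text \<open>\<open>H\<^bsup>l1\<^esup> \<otimes> H\<^bsup>l2\<^esup>\<close> is realised by bihomogeneous polynomial functions on
  \<open>\<complex>\<^sup>2 \<times> \<complex>\<^sup>2\<close>, the tensor \<open>f \<otimes> g\<close> being \<open>(v, w) \<mapsto> f v * g w\<close>.\<close>

definition tensor_psi :: "real \<Rightarrow> real \<Rightarrow> real \<times> real \<Rightarrow> (complex^2) \<times> (complex^2) \<Rightarrow> complex" where
  "tensor_psi l1 l2 = (\<lambda>(j1, j2) (v, w). psi l1 j1 v * psi l2 j2 w)"

definition HHinner :: "real \<Rightarrow> real \<Rightarrow> ((complex^2) \<times> (complex^2) \<Rightarrow> complex) \<Rightarrow>
    ((complex^2) \<times> (complex^2) \<Rightarrow> complex) \<Rightarrow> complex" where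
  "HHinner l1 l2 = cinner_basis (weights l1 \<times> weights l2) (tensor_psi l1 l2)"

text \<open>With \<open>T\<^sup>l k p = p \<circ> k\<^sup>t\<close> one has
  \<open>(T k1 f \<otimes> T k2 g) (v, w) = f (k1\<^sup>t v) * g (k2\<^sup>t w)\<close>, so the outer tensor product
  representation is precomposition with \<open>(k1\<^sup>t, k2\<^sup>t)\<close>.\<close>

definition Trep :: "complex^2^2 \<Rightarrow> (complex^2 \<Rightarrow> complex) \<Rightarrow> (complex^2 \<Rightarrow> complex)" where
  "Trep k p = (\<lambda>v. p (transpose k *v v))"

definition TTrep :: "(complex^2^2) \<times> (complex^2^2) \<Rightarrow> ((complex^2) \<times> (complex^2) \<Rightarrow> complex) \<Rightarrow>
    ((complex^2) \<times> (complex^2) \<Rightarrow> complex)" where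
  "TTrep = (\<lambda>(k1, k2) F (v, w). F (transpose k1 *v v, transpose k2 *v w))"

lemma TTrep_tensor:
  "TTrep (k1, k2) (\<lambda>(v, w). f v * g w) = (\<lambda>(v, w). Trep k1 f v * Trep k2 g w)"
  by (simp add: TTrep_def Trep_def fun_eq_iff)

subsection \<open>Clebsch-Gordan coefficients\<close>

text \<open>The coefficient \<open>C\<^bsup>l1,l2,l\<^esup>\<^bsub>j1,j2,j\<^esub>\<close> in the Condon-Shortley phase
  convention, given by Racah's formula. The sum ranges over all \<open>k\<close> for which the factorials in
  the denominator have nonnegative arguments. It is meant for \<open>\<bar>l1 - l2\<bar> \<le> l \<le> l1 + l2\<close>
  with \<open>l1 + l2 - l\<close> an integer.\<close>

definition clebsch_gordan :: "real \<Rightarrow> real \<Rightarrow> real \<Rightarrow> real \<Rightarrow> real \<Rightarrow> real \<Rightarrow> real" where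
  "clebsch_gordan l1 l2 l j1 j2 j = (if j = j1 + j2 then
     sqrt ((2 * l + 1) * rfact (l + l1 - l2) * rfact (l - l1 + l2) * rfact (l1 + l2 - l)
           / rfact (l1 + l2 + l + 1))
     * sqrt (rfact (l + j) * rfact (l - j) * rfact (l1 - j1) * rfact (l1 + j1)
             * rfact (l2 - j2) * rfact (l2 + j2))
     * (\<Sum>k\<in>{k::nat. real k \<le> l1 + l2 - l \<and> real k \<le> l1 - j1 \<and> real k \<le> l2 + j2
                     \<and> 0 \<le> l - l2 + j1 + real k \<and> 0 \<le> l - l1 - j2 + real k}.
          (- 1) ^ k / (fact k * rfact (l1 + l2 - l - real k) * rfact (l1 - j1 - real k)
             * rfact (l2 + j2 - real k) * rfact (l - l2 + j1 + real k)
             * rfact (l - l1 - j2 + real k)))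
   else 0)"

subsection \<open>Spherical functions and the weight\<close>

text \<open>\<open>\<beta>\<close> is the linear extension of
  \<open>psi l j \<mapsto> \<Sum> C\<^bsup>l1,l2,l\<^esup>\<^bsub>j1,j2,j\<^esub> psi l1 j1 \<otimes> psi l2 j2\<close>.\<close>

definition beta :: "real \<Rightarrow> real \<Rightarrow> real \<Rightarrow> (complex^2 \<Rightarrow> complex) \<Rightarrow>
    ((complex^2) \<times> (complex^2) \<Rightarrow> complex)" where
  "beta l1 l2 l f = (\<lambda>z. \<Sum>j\<in>weights l. coords (weights l) (psi l) f j *
     (\<Sum>(j1, j2)\<in>weights l1 \<times> weights l2.
        of_real (clebsch_gordan l1 l2 l j1 j2 j) * tensor_psi l1 l2 (j1, j2) z))"

definition beta_adj :: "real \<Rightarrow> real \<Rightarrow> real \<Rightarrow> ((complex^2) \<times> (complex^2) \<Rightarrow> complex) \<Rightarrow>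
    (complex^2 \<Rightarrow> complex)" where
  "beta_adj l1 l2 l F =
     (THE f. f \<in> Hspace l \<and> (\<forall>g\<in>Hspace l. Hinner l g f = HHinner l1 l2 (beta l1 l2 l g) F))"

definition Phi :: "real \<Rightarrow> real \<Rightarrow> real \<Rightarrow> (complex^2^2) \<times> (complex^2^2) \<Rightarrow>
    (complex^2 \<Rightarrow> complex) \<Rightarrow> (complex^2 \<Rightarrow> complex)" where
  "Phi l1 l2 l x = beta_adj l1 l2 l \<circ> TTrep x \<circ> beta l1 l2 l"

definition Phi0 :: "real \<Rightarrow> (complex^2^2) \<times> (complex^2^2) \<Rightarrow> real \<Rightarrow> real \<Rightarrow> complex" where
  "Phi0 l a p q = mat_entry l (Phi ((l + p) / 2) ((l - p) / 2) l a) q q"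

text \<open>\<open>weight_V l t p q\<close> is the \<open>(p, q)\<close> entry of \<open>V\<^sup>l(a\<^sub>t)\<close>, i.e. of
  \<open>\<Phi>\<^sub>0(a\<^sub>t) \<Phi>\<^sub>0(a\<^sub>t)\<^sup>* sin\<^sup>2 t\<close>.\<close>

definition weight_V :: "real \<Rightarrow> real \<Rightarrow> real \<Rightarrow> real \<Rightarrow> complex" where
  "weight_V l t p q =
     (\<Sum>j\<in>weights l. Phi0 l (a_elt t) p j * cnj (Phi0 l (a_elt t) q j)) * of_real ((sin t)\<^sup>2)"

end

theory Submission
  imports Defs
begin

text \<open>
  Put \<open>N = 2 l\<close>, \<open>a = l + p\<close>, \<open>d = l + q\<close>, \<open>z = e\<^bsup>i t\<^esup>\<close>, and index the columns of
  \<open>\<Phi>\<^sub>0\<close> by \<open>b = l + j\<close>. Since \<open>(l + p) / 2 + (l - p) / 2 = l\<close>, only the Clebsch-Gordan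
  coefficients of the top component of a tensor product occur. Racah's sum then has a single
  term, and the squared coefficients are the hypergeometric weights
  \<open>C(a, i) C(N - a, b - i) / C(N, b)\<close> (\<open>clebsch_gordan_top_squared\<close>). These weights are symmetric
  under exchanging \<open>a\<close> and \<open>b\<close>, so multiplication by \<open>C(N, a)\<close> removes the denominator and
  \<open>C(N, a) \<Phi>\<^sub>0(a\<^sub>t)\<^bsub>p,j\<^esub>\<close> is the coefficient of \<open>w\<^sup>a\<close> in
  \<open>z\<^bsup>b - N/2\<^esup> (1 + w/z)\<^sup>b (1 + w z)\<^bsup>N - b\<^esup>\<close> (\<open>Phi0_generating_function\<close>).

  Complex conjugation exchanges \<open>z\<close> and \<open>1/z\<close>. Hence, up to the factor \<open>sin\<^sup>2 t\<close>, the number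
  \<open>C(N, a) C(N, d) V\<^bsub>p,q\<^esub>\<close> is the coefficient of \<open>w\<^sup>a v\<^sup>d\<close> in the geometric sum
  \<open>\<Sum>\<^sub>b A\<^sup>b B\<^bsup>N - b\<^esup> = (A\<^bsup>N + 1\<^esup> - B\<^bsup>N + 1\<^esup>) / (A - B)\<close> with
  \<open>A = (1 + w/z) (1 + v z)\<close> and \<open>B = (1 + w z) (1 + v/z)\<close>. The decisive fact is the
  factorisation \<open>A - B = (v - w) (z - 1/z)\<close>. Multiplying by \<open>v - w\<close> relates the coefficients at
  \<open>(a, d)\<close> and \<open>(a + 1, d - 1)\<close>, and \<open>(A\<^bsup>N + 1\<^esup> - B\<^bsup>N + 1\<^esup>) / (z - 1/z)\<close> has
  coefficients that are products of binomial coefficients and Chebyshev polynomials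
  (\<open>pairing_telescope\<close>). Descending from \<open>d\<close> to \<open>0\<close> gives
  \<open>C(N, a) C(N, d) V\<^bsub>p,q\<^esub> =
    sin\<^sup>2 t \<Sum>\<^bsub>n \<le> d\<^esub> C(N + 1, a + d + 1 - n) C(N + 1, n) U\<^bsub>a + d - 2 n\<^esub>(cos t)\<close>,
  which displays the coefficients as rational numbers, positive because \<open>a + d \<le> N\<close>.
\<close>

section \<open>Coordinates with respect to a linearly independent family\<close>

text \<open>The functions \<open>coords\<close> and \<open>beta_adj\<close> are definite descriptions. They are evaluated by
  writing every vector as a combination of a linearly independent family and reading off
  coefficients.\<close>

definition independent_family :: "'i set \<Rightarrow> ('i \<Rightarrow> 'v \<Rightarrow> complex) \<Rightarrow> bool" where
  "independent_family I e \<longleftrightarrow> (\<forall>c. (\<forall>v. (\<Sum>i\<in>I. c i * e i v) = 0) \<longrightarrow> (\<forall>i\<in>I. c i = 0))"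

lemma independent_familyD:
  assumes "independent_family I e" "\<And>v. (\<Sum>i\<in>I. c i * e i v) = 0" "i \<in> I"
  shows "c i = 0"
  using assms unfolding independent_family_def by blast

lemma coords_combination:
  assumes "independent_family I e"
  shows "coords I e (\<lambda>v. \<Sum>i\<in>I. c i * e i v) = (\<lambda>i. if i \<in> I then c i else 0)"
  unfolding coords_def
proof (rule the_equality)
  show "(\<forall>i. i \<notin> I \<longrightarrow> (if i \<in> I then c i else 0) = 0) \<and>
    (\<lambda>v. \<Sum>i\<in>I. c i * e i v) = (\<lambda>v. \<Sum>i\<in>I. (if i \<in> I then c i else 0) * e i v)"
    by (auto intro!: sum.cong)
next
  fix c' assume c': "(\<forall>i. i \<notin> I \<longrightarrow> c' i = 0) \<and>
    (\<lambda>v. \<Sum>i\<in>I. c i * e i v) = (\<lambda>v. \<Sum>i\<in>I. c' i * e i v)"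
  have "(\<Sum>i\<in>I. (c' i - c i) * e i v) = 0" for v
    using fun_cong[OF conjunct2[OF c'], of v] by (simp add: left_diff_distrib sum_subtractf)
  from independent_familyD[OF assms this] have "c' i = c i" if "i \<in> I" for i
    using that by simp
  with c' show "c' = (\<lambda>i. if i \<in> I then c i else 0)" by auto
qed

lemma coords_expansion:
  assumes "independent_family I e" "f \<in> cspan I e"
  shows "f = (\<lambda>v. \<Sum>i\<in>I. coords I e f i * e i v)"
proof -
  obtain c where "f = (\<lambda>v. \<Sum>i\<in>I. c i * e i v)"
    using assms(2) by (auto simp: cspan_def)
  then show ?thesis by (simp add: coords_combination[OF assms(1)] cong: sum.cong)
qed

lemma basis_eq_combination:
  assumes "finite I" "j \<in> I"
  shows "e j = (\<lambda>v. \<Sum>i\<in>I. (if i = j then 1 else 0) * e i v :: complex)"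
proof
  fix v
  have "(\<Sum>i\<in>I. (if i = j then 1 else 0) * e i v) = (\<Sum>i\<in>I. if i = j then e i v else 0)"
    by (intro sum.cong) auto
  then show "e j v = (\<Sum>i\<in>I. (if i = j then 1 else 0) * e i v)" using assms by simp
qed

lemma basis_in_cspan: "finite I \<Longrightarrow> j \<in> I \<Longrightarrow> e j \<in> cspan I e"
  unfolding cspan_def by (rule CollectI, rule exI, rule basis_eq_combination)

lemma coords_basis:
  assumes "independent_family I e" "finite I" "j \<in> I"
  shows "coords I e (e j) = (\<lambda>i. if i = j then 1 else 0)"
proof -
  have "coords I e (e j) = (\<lambda>i. if i \<in> I then if i = j then 1 else 0 else 0)"
    by (subst basis_eq_combination[OF assms(2,3)]) (rule coords_combination[OF assms(1)])
  with assms(3) show ?thesis by auto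
qed

text \<open>For fixed \<open>w\<close> a vanishing combination of the \<open>e i v * f j w\<close> is a vanishing
  combination of the \<open>e i v\<close>; its coefficients are combinations of the \<open>f j w\<close> that vanish for
  every \<open>w\<close>.\<close>

lemma independent_family_tensor:
  assumes "independent_family I e" "independent_family J f"
  shows "independent_family (I \<times> J) (\<lambda>(i, j) (v, w). e i v * f j w)"
  unfolding independent_family_def
proof (intro allI impI ballI)
  fix c x
  assume zero: "\<forall>u. (\<Sum>x\<in>I \<times> J. c x * (case x of (i, j) \<Rightarrow> \<lambda>(v, w). e i v * f j w) u) = 0"
    and "x \<in> I \<times> J"
  then obtain i j where x: "x = (i, j)" "i \<in> I" "j \<in> J" by auto
  have "(\<Sum>i\<in>I. (\<Sum>j\<in>J. c (i, j) * f j w) * e i v) = 0" for v w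
    using zero[rule_format, of "(v, w)"]
    by (simp add: sum.cartesian_product' sum_distrib_left sum_distrib_right mult_ac case_prod_unfold)
  from independent_familyD[OF assms(1) this \<open>i \<in> I\<close>]
  have "(\<Sum>j\<in>J. c (i, j) * f j w) = 0" for w .
  from independent_familyD[OF assms(2) this \<open>j \<in> J\<close>] show "c x = 0" by (simp add: x)
qed

section \<open>The monomial bases\<close>

lemma weights_half: "weights (real N / 2) = (\<lambda>k. real k - real N / 2) ` {..N}"
  by (simp add: weights_def)

lemma finite_weights: "finite (weights l)"
  by (simp add: weights_def)

lemma sum_weights_half:
  "(\<Sum>j\<in>weights (real N / 2). f j) = (\<Sum>k\<le>N. f (real k - real N / 2))"
  unfolding weights_half by (subst sum.reindex) (auto simp: inj_on_def)

lemma psi_half: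
  assumes "k \<le> N"
  shows "psi (real N / 2) (real k - real N / 2) v =
    of_real (sqrt (real (N choose k))) * (v $ 1) ^ (N - k) * (v $ 2) ^ k"
proof -
  have 1: "real N / 2 - (real k - real N / 2) = real (N - k)" using assms by simp
  have 2: "real N / 2 + (real k - real N / 2) = real k" by simp
  have 3: "2 * (real N / 2) = real N" by simp
  show ?thesis
    unfolding psi_def 1 2 3 using binomial_symmetric[OF assms] by simp
qed

text \<open>On the line \<open>x = 1\<close> the basis \<open>psi\<close> becomes the powers of \<open>y\<close> up to nonzero
  scalars.\<close>

lemma independent_psi: "independent_family (weights (real N / 2)) (psi (real N / 2))"
  unfolding independent_family_def
proof (intro allI impI ballI)
  fix c j
  assume zero: "\<forall>v. (\<Sum>j\<in>weights (real N / 2). c j * psi (real N / 2) j v) = 0"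
    and "j \<in> weights (real N / 2)"
  then obtain k where k: "k \<le> N" "j = real k - real N / 2" by (auto simp: weights_half)
  let ?c = "\<lambda>k. c (real k - real N / 2) * of_real (sqrt (real (N choose k)))"
  have "(\<Sum>k\<le>N. ?c k * y ^ k) = 0" for y :: complex
    proof -
    have "(\<Sum>k\<le>N. ?c k * y ^ k) =
      (\<Sum>k\<le>N. c (real k - real N / 2) * psi (real N / 2) (real k - real N / 2) (vector [1, y]))"
      by (intro sum.cong) (simp_all add: psi_half)
    then show ?thesis
      using zero[rule_format, of "vector [1, y]"] by (simp add: sum_weights_half)
  qed
  then have "?c k = 0" using k(1) polyfun_eq_0[of ?c N] by auto
  then show "c j = 0" using k by simp
qed

lemma Hspace_half: "Hspace (real N / 2) = cspan (weights (real N / 2)) (psi (real N / 2))"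
proof -
  let ?s = "\<lambda>k. complex_of_real (sqrt (real (N choose k)))"
  have s: "?s k \<noteq> 0" if "k \<le> N" for k using that by simp
  have N: "nat \<lfloor>2 * (real N / 2)\<rfloor> = N" by simp
  show ?thesis
  proof (intro equalityI subsetI)
    fix f assume "f \<in> Hspace (real N / 2)"
    then obtain c where f: "f = (\<lambda>v. \<Sum>k\<le>N. c k * ((v $ 1) ^ (N - k) * (v $ 2) ^ k))"
      unfolding Hspace_def cspan_def N by auto
    let ?d = "\<lambda>j. c (nat \<lfloor>real N / 2 + j\<rfloor>) / ?s (nat \<lfloor>real N / 2 + j\<rfloor>)"
    have "f = (\<lambda>v. \<Sum>j\<in>weights (real N / 2). ?d j * psi (real N / 2) j v)"
      unfolding f by (auto simp: sum_weights_half psi_half fun_eq_iff intro!: sum.cong)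
    then show "f \<in> cspan (weights (real N / 2)) (psi (real N / 2))"
      unfolding cspan_def by (intro CollectI exI)
  next
    fix f assume "f \<in> cspan (weights (real N / 2)) (psi (real N / 2))"
    then obtain c where f: "f = (\<lambda>v. \<Sum>j\<in>weights (real N / 2). c j * psi (real N / 2) j v)"
      unfolding cspan_def by auto
    have "f = (\<lambda>v. \<Sum>k\<le>N. (c (real k - real N / 2) * ?s k) * ((v $ 1) ^ (N - k) * (v $ 2) ^ k))"
      unfolding f by (auto simp: sum_weights_half psi_half mult_ac fun_eq_iff intro!: sum.cong)
    then show "f \<in> Hspace (real N / 2)"
      unfolding Hspace_def cspan_def N by (intro CollectI exI)
  qed
qed

lemma independent_tensor_psi:
  "independent_family (weights (real m / 2) \<times> weights (real n / 2)) (tensor_psi (real m / 2) (real n / 2))"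
  unfolding tensor_psi_def
  by (rule independent_family_tensor[OF independent_psi independent_psi])

lemma coeff_one_linear_power: "coeff ([:1, x:] ^ n) i = of_nat (n choose i) * x ^ i"
  for x :: "'a::comm_semiring_1"
proof (cases "i \<le> n")
  case True
  then show ?thesis by (simp add: coeff_linear_poly_power)
next
  case False
  have "degree ([:1, x:] ^ n) \<le> 1 * n"
    by (rule order_trans[OF degree_power_le]) (intro mult_right_mono, auto)
  with False show ?thesis by (simp add: coeff_eq_0 binomial_eq_0)
qed

section \<open>Diagonal entries of the spherical functions\<close>

abbreviation CG :: "real \<Rightarrow> real \<Rightarrow> real \<Rightarrow> real \<times> real \<Rightarrow> real \<Rightarrow> complex" where
  "CG l1 l2 l i j \<equiv> of_real (clebsch_gordan l1 l2 l (fst i) (snd i) j)"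

lemma beta_expansion:
  "beta l1 l2 l f = (\<lambda>z. \<Sum>i\<in>weights l1 \<times> weights l2.
     (\<Sum>j\<in>weights l. coords (weights l) (psi l) f j * CG l1 l2 l i j) * tensor_psi l1 l2 i z)"
  unfolding beta_def
  by (rule ext, subst sum_distrib_right, subst sum.swap)
     (simp add: sum_distrib_left case_prod_unfold mult.assoc)

text \<open>In orthonormal bases the adjoint has the conjugate transposed matrix, and
  Clebsch-Gordan coefficients are real.\<close>

lemma beta_adj_combination:
  fixes n1 n2 n :: nat
  defines "l1 \<equiv> real n1 / 2" and "l2 \<equiv> real n2 / 2" and "l \<equiv> real n / 2"
  shows "beta_adj l1 l2 l (\<lambda>z. \<Sum>i\<in>weights l1 \<times> weights l2. c i * tensor_psi l1 l2 i z) =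
    (\<lambda>v. \<Sum>j\<in>weights l. (\<Sum>i\<in>weights l1 \<times> weights l2. CG l1 l2 l i j * c i) * psi l j v)"
    (is "beta_adj l1 l2 l ?F = ?f")
proof -
  let ?I = "weights l" and ?J = "weights l1 \<times> weights l2"
  let ?b = "\<lambda>j. \<Sum>i\<in>?J. CG l1 l2 l i j * c i"
  have ind: "independent_family ?I (psi l)" unfolding l_def by (rule independent_psi)
  have indT: "independent_family ?J (tensor_psi l1 l2)"
    unfolding l1_def l2_def by (rule independent_tensor_psi)
  have H: "Hspace l = cspan ?I (psi l)" unfolding l_def by (rule Hspace_half)
  note fin = finite_weights[of l]
  have HH: "HHinner l1 l2 (beta l1 l2 l g) ?F = (\<Sum>j\<in>?I. coords ?I (psi l) g j * cnj (?b j))" for g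
  proof -
    have "HHinner l1 l2 (beta l1 l2 l g) ?F =
      (\<Sum>i\<in>?J. (\<Sum>j\<in>?I. coords ?I (psi l) g j * CG l1 l2 l i j) * cnj (c i))"
      unfolding HHinner_def cinner_basis_def beta_expansion coords_combination[OF indT]
      by (intro sum.cong) auto
    also have "\<dots> = (\<Sum>j\<in>?I. \<Sum>i\<in>?J. coords ?I (psi l) g j * CG l1 l2 l i j * cnj (c i))"
      by (subst sum.swap) (simp add: sum_distrib_right)
    finally show ?thesis by (simp add: sum_distrib_left mult.assoc)
  qed
  show ?thesis unfolding beta_adj_def
  proof (rule the_equality)
    have "?f \<in> Hspace l" unfolding H cspan_def by auto
    moreover have "Hinner l g ?f = HHinner l1 l2 (beta l1 l2 l g) ?F" for g
      unfolding HH Hinner_def cinner_basis_def coords_combination[OF ind]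
      by (intro sum.cong) auto
    ultimately show "?f \<in> Hspace l \<and> (\<forall>g\<in>Hspace l. Hinner l g ?f = HHinner l1 l2 (beta l1 l2 l g) ?F)"
      by blast
  next
    fix f assume f: "f \<in> Hspace l \<and> (\<forall>g\<in>Hspace l. Hinner l g f = HHinner l1 l2 (beta l1 l2 l g) ?F)"
    have "coords ?I (psi l) f j = ?b j" if j: "j \<in> ?I" for j
    proof -
      have "psi l j \<in> Hspace l" unfolding H by (rule basis_in_cspan[OF fin j])
      with f have "Hinner l (psi l j) f = HHinner l1 l2 (beta l1 l2 l (psi l j)) ?F" by blast
      then have eq: "(\<Sum>k\<in>?I. (if k = j then 1 else 0) * cnj (coords ?I (psi l) f k)) =
        (\<Sum>k\<in>?I. (if k = j then 1 else 0) * cnj (?b k))"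
        unfolding HH unfolding Hinner_def cinner_basis_def coords_basis[OF ind fin j] .
      have delta: "(\<Sum>k\<in>?I. (if k = j then 1 else 0) * h k) = h j" for h :: "real \<Rightarrow> complex"
        using fin j by (simp add: if_distrib[of "\<lambda>x. x * _"] cong: if_cong)
      from eq show ?thesis unfolding delta complex_cnj_cancel_iff .
    qed
    moreover have "f = (\<lambda>v. \<Sum>j\<in>?I. coords ?I (psi l) f j * psi l j v)"
      using coords_expansion[OF ind] f H by blast
    ultimately show "f = ?f" by (metis (no_types, lifting) sum.cong)
  qed
qed

lemma transpose_m_elt:
  "transpose (m_elt t) *v v = vector [cis (t / 2) * v $ 1, cis (- (t / 2)) * v $ 2]"
  by (simp add: vec_eq_iff forall_2 matrix_vector_mult_def sum_2 transpose_def m_elt_def)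

text \<open>The basis vectors are weight vectors for the diagonal torus.\<close>

lemma psi_m_elt:
  assumes "j \<in> weights (real n / 2)"
  shows "psi (real n / 2) j (transpose (m_elt t) *v v) = cis (- j * t) * psi (real n / 2) j v"
proof -
  obtain k where k: "k \<le> n" "j = real k - real n / 2"
    using assms by (auto simp: weights_half)
  have "real (n - k) * (t / 2) + real k * - (t / 2) = - j * t"
    using k(1) by (simp add: k(2) of_nat_diff field_simps)
  then have e: "cis (- j * t) = cis (t / 2) ^ (n - k) * cis (- (t / 2)) ^ k"
    unfolding Complex.DeMoivre cis_mult by simp
  show ?thesis
    unfolding e unfolding k(2) psi_half[OF k(1)] transpose_m_elt vector_2 power_mult_distrib
    by (simp only: mult_ac)
qed

lemma TTrep_a_elt_tensor_psi:
  assumes "i \<in> weights (real m / 2) \<times> weights (real n / 2)"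
  shows "tensor_psi (real m / 2) (real n / 2) i (transpose (m_elt t) *v v, transpose (m_elt (- t)) *v w) =
    cis ((snd i - fst i) * t) * tensor_psi (real m / 2) (real n / 2) i (v, w)"
proof -
  obtain j1 j2 where i: "i = (j1, j2)" "j1 \<in> weights (real m / 2)" "j2 \<in> weights (real n / 2)"
    using assms by auto
  have "cis ((j2 - j1) * t) = cis (- j1 * t) * cis (- j2 * - t)"
    by (simp add: cis_mult algebra_simps)
  then show ?thesis
    unfolding i(1) tensor_psi_def prod.case fst_conv snd_conv psi_m_elt[OF i(2)] psi_m_elt[OF i(3)]
    by (simp only: mult_ac)
qed

lemma Phi_diagonal_entry:
  fixes n1 n2 n :: nat
  defines "l1 \<equiv> real n1 / 2" and "l2 \<equiv> real n2 / 2" and "l \<equiv> real n / 2"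
  assumes j: "j \<in> weights l"
  shows "mat_entry l (Phi l1 l2 l (a_elt t)) j j =
    (\<Sum>(j1, j2)\<in>weights l1 \<times> weights l2.
       of_real ((clebsch_gordan l1 l2 l j1 j2 j)\<^sup>2) * cis ((j2 - j1) * t))"
proof -
  let ?I = "weights l" and ?J = "weights l1 \<times> weights l2"
  have ind: "independent_family ?I (psi l)" unfolding l_def by (rule independent_psi)
  have b: "beta l1 l2 l (psi l j) = (\<lambda>z. \<Sum>i\<in>?J. CG l1 l2 l i j * tensor_psi l1 l2 i z)"
    unfolding beta_expansion coords_basis[OF ind finite_weights j]
    using j finite_weights[of l] by (simp add: if_distrib[of "\<lambda>x. x * _"] cong: if_cong)
  have T: "TTrep (a_elt t) (beta l1 l2 l (psi l j)) =
    (\<lambda>z. \<Sum>i\<in>?J. (CG l1 l2 l i j * cis ((snd i - fst i) * t)) * tensor_psi l1 l2 i z)"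
  proof (rule ext, safe)
    fix v w
    show "TTrep (a_elt t) (beta l1 l2 l (psi l j)) (v, w) =
      (\<Sum>i\<in>?J. (CG l1 l2 l i j * cis ((snd i - fst i) * t)) * tensor_psi l1 l2 i (v, w))"
      unfolding b TTrep_def a_elt_def prod.case
      using TTrep_a_elt_tensor_psi[of _ n1 n2, folded l1_def l2_def]
      by (intro sum.cong) (auto simp: mult.assoc)
  qed
  have "mat_entry l (Phi l1 l2 l (a_elt t)) j j =
    (\<Sum>i\<in>?J. CG l1 l2 l i j * (CG l1 l2 l i j * cis ((snd i - fst i) * t)))"
    unfolding mat_entry_def Phi_def comp_def T
    unfolding l1_def l2_def l_def beta_adj_combination
    unfolding coords_combination[OF independent_psi] using j by (simp add: l_def)
  then show ?thesis by (simp add: case_prod_unfold power2_eq_square mult.assoc)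
qed

section \<open>Clebsch-Gordan coefficients of the Cartan component\<close>

text \<open>For \<open>l = l1 + l2\<close> the term \<open>k = 0\<close> is the only one in Racah's sum, and the factorials
  under the square roots combine with it to binomial coefficients.\<close>

lemma clebsch_gordan_top_squared:
  fixes m n i1 i2 b :: nat
  assumes "i1 \<le> m" "i2 \<le> n" "b \<le> m + n"
  shows "(clebsch_gordan (real m / 2) (real n / 2) (real (m + n) / 2)
      (real i1 - real m / 2) (real i2 - real n / 2) (real b - real (m + n) / 2))\<^sup>2 =
    (if i1 + i2 = b then real (m choose i1) * real (n choose i2) / real ((m + n) choose b) else 0)"
proof (cases "i1 + i2 = b")
  case False
  then have "real b \<noteq> real i1 + real i2" by (metis of_nat_add of_nat_eq_iff)
  then have "real b - real (m + n) / 2 \<noteq> real i1 - real m / 2 + (real i2 - real n / 2)"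
    by (simp add: add_divide_distrib)
  with False show ?thesis by (simp add: clebsch_gordan_def)
next
  case True
  have rfact: "rfact x = fact k" if "x = real k" for x k
    using that by (simp add: rfact_def)
  have singleton: "(\<Sum>k\<in>{0}. g k) = g 0" for g :: "nat \<Rightarrow> real" by simp
  have K: "{k::nat. real k \<le> real m / 2 + real n / 2 - real (m + n) / 2 \<and>
      real k \<le> real m / 2 - (real i1 - real m / 2) \<and>
      real k \<le> real n / 2 + (real i2 - real n / 2) \<and>
      0 \<le> real (m + n) / 2 - real n / 2 + (real i1 - real m / 2) + real k \<and>
      0 \<le> real (m + n) / 2 - real m / 2 - (real i2 - real n / 2) + real k} = {0}"
    using assms by (auto simp: add_divide_distrib)
  have eq: "real b - real (m + n) / 2 = real i1 - real m / 2 + (real i2 - real n / 2)"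
    by (simp add: True[symmetric] field_simps)
  have f1: "rfact (real (m + n) / 2 + real m / 2 - real n / 2) = fact m"
    by (intro rfact) (simp add: field_simps)
  have f2: "rfact (real (m + n) / 2 - real m / 2 + real n / 2) = fact n"
    by (intro rfact) (simp add: field_simps)
  have f3: "rfact (real m / 2 + real n / 2 - real (m + n) / 2) = fact 0"
    by (intro rfact) (simp add: field_simps)
  have f4: "rfact (real m / 2 + real n / 2 + real (m + n) / 2 + 1) = fact (m + n + 1)"
    by (intro rfact) (simp add: field_simps)
  have f5: "rfact (real (m + n) / 2 + (real b - real (m + n) / 2)) = fact b"
    by (intro rfact) simp
  have f6: "rfact (real (m + n) / 2 - (real b - real (m + n) / 2)) = fact (m + n - b)"
    using assms by (intro rfact) (simp add: field_simps of_nat_diff)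
  have f7: "rfact (real m / 2 - (real i1 - real m / 2)) = fact (m - i1)"
    using assms by (intro rfact) (simp add: field_simps of_nat_diff)
  have f8: "rfact (real m / 2 + (real i1 - real m / 2)) = fact i1"
    by (intro rfact) simp
  have f9: "rfact (real n / 2 - (real i2 - real n / 2)) = fact (n - i2)"
    using assms by (intro rfact) (simp add: field_simps of_nat_diff)
  have f10: "rfact (real n / 2 + (real i2 - real n / 2)) = fact i2"
    by (intro rfact) simp
  have f11: "rfact (real (m + n) / 2 - real n / 2 + (real i1 - real m / 2)) = fact i1"
    by (intro rfact) (simp add: field_simps)
  have f12: "rfact (real (m + n) / 2 - real m / 2 - (real i2 - real n / 2)) = fact (n - i2)"
    using assms by (intro rfact) (simp add: field_simps of_nat_diff)
  define s where "s = 2 * (real (m + n) / 2) + 1"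
  have s: "s > 0" unfolding s_def by linarith
  have f: "fact (m + n + 1) = s * fact (m + n)" by (simp add: s_def)
  have "(clebsch_gordan (real m / 2) (real n / 2) (real (m + n) / 2)
      (real i1 - real m / 2) (real i2 - real n / 2) (real b - real (m + n) / 2))\<^sup>2 =
    (s * fact m * fact n * fact 0 / fact (m + n + 1)) *
    (fact b * fact (m + n - b) * fact (m - i1) * fact i1 * fact (n - i2) * fact i2) *
    (1 / (fact (m - i1) * fact i2 * fact i1 * fact (n - i2)))\<^sup>2"
    unfolding s_def clebsch_gordan_def if_P[OF eq] K singleton of_nat_0 diff_zero add_0_right
      f1 f2 f3 f4 f5 f6 f7 f8 f9 f10 f11 f12
    by (simp add: power_mult_distrib power_divide)
  also have "\<dots> = (fact m / (fact i1 * fact (m - i1))) * (fact n / (fact i2 * fact (n - i2))) /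
      (fact (m + n) / (fact b * fact (m + n - b)))"
    unfolding f using s by (simp add: field_simps power2_eq_square)
  also have "\<dots> = real (m choose i1) * real (n choose i2) / real ((m + n) choose b)"
    using assms by (simp add: binomial_fact)
  finally show ?thesis using True by simp
qed

text \<open>Both sides are the same quotient of factorials. In probabilistic terms, the size of the
  intersection of a random \<open>m\<close>-set with a fixed \<open>b\<close>-set has the same distribution as
  that of a random \<open>b\<close>-set with a fixed \<open>m\<close>-set.\<close>

lemma hypergeometric_symmetry:
  fixes m n i b :: nat
  assumes "i \<le> m" "i \<le> b" "b - i \<le> n"
  shows "real ((m + n) choose m) * (real (m choose i) * real (n choose (b - i)) / real ((m + n) choose b)) =
    real (b choose i) * real ((m + n - b) choose (m - i))"
proof -
  have e: "m + n - b - (m - i) = n - (b - i)" "m + n - m = n" using assms by auto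
  have le: "m \<le> m + n" "b \<le> m + n" "m - i \<le> m + n - b" using assms by auto
  show ?thesis
    unfolding binomial_fact[OF le(1)] binomial_fact[OF le(2)] binomial_fact[OF le(3)]
      binomial_fact[OF assms(1)] binomial_fact[OF assms(2)] binomial_fact[OF assms(3)] e
    by (simp add: field_simps)
qed

text \<open>With \<open>i1 + i2 = b\<close> the phase is
  \<open>j2 - j1 = b - 2 i1 + a - N/2 = (b - N/2) - i1 + (a - i1)\<close>. By the hypergeometric symmetry the
  sum over \<open>i1\<close> becomes the convolution of the coefficients of
  \<open>(1 + w/z)\<^sup>b\<close> and \<open>(1 + w z)\<^bsup>N - b\<^esup>\<close>.\<close>

lemma Phi0_generating_function:
  assumes "a \<le> N" "b \<le> N"
  shows "of_nat (N choose a) * Phi0 (real N / 2) (a_elt t) (real a - real N / 2) (real b - real N / 2) =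
    cis ((real b - real N / 2) * t) * coeff ([:1, cis (- t):] ^ b * [:1, cis t:] ^ (N - b)) a"
proof -
  define n where "n = N - a"
  have N: "N = a + n" using assms n_def by simp
  let ?w = "\<lambda>i1 i2. (if i1 + i2 = b then real (a choose i1) * real (n choose i2) / real (N choose b) else 0)"
  let ?e = "\<lambda>i. cis ((real b - 2 * real i + real a - real N / 2) * t)"
  have l1: "(real N / 2 + (real a - real N / 2)) / 2 = real a / 2"
    and l2: "(real N / 2 - (real a - real N / 2)) / 2 = real n / 2"
    by (simp_all add: N)
  have wb: "real b - real N / 2 \<in> weights (real N / 2)" using assms by (auto simp: weights_half)
  have "Phi0 (real N / 2) (a_elt t) (real a - real N / 2) (real b - real N / 2) =
    (\<Sum>i1\<le>a. \<Sum>i2\<le>n. of_real (?w i1 i2) *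
       cis ((real i2 - real n / 2 - (real i1 - real a / 2)) * t))"
    unfolding Phi0_def l1 l2 Phi_diagonal_entry[OF wb]
    unfolding sum.cartesian_product[symmetric] sum_weights_half
    using assms clebsch_gordan_top_squared[of _ a _ n b] by (intro sum.cong) (auto simp: N)
  also have "\<dots> = (\<Sum>i1\<le>a. \<Sum>i2\<le>n. if i1 + i2 = b then
      of_real (real (a choose i1) * real (n choose i2) / real (N choose b)) * ?e i1 else 0)"
    (is "(\<Sum>i1\<le>a. \<Sum>i2\<le>n. ?lhs i1 i2) = (\<Sum>i1\<le>a. \<Sum>i2\<le>n. ?rhs i1 i2)")
  proof (intro sum.cong refl)
    fix i1 i2
    have "(real i2 - real n / 2 - (real i1 - real a / 2)) * t =
      (real b - 2 * real i1 + real a - real N / 2) * t" if "i1 + i2 = b"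
      using that by (auto simp: N add_divide_distrib)
    then show "?lhs i1 i2 = ?rhs i1 i2"
      by (cases "i1 + i2 = b") (simp_all only: simp_thms if_True if_False of_real_0 mult_zero_left)
  qed
  also have "\<dots> = (\<Sum>i\<le>a. if i \<le> b \<and> b - i \<le> n then
      of_real (real (a choose i) * real (n choose (b - i)) / real (N choose b)) * ?e i else 0)"
    (is "_ = (\<Sum>i\<le>a. ?r i)")
  proof (intro sum.cong refl)
    fix i
    let ?g = "\<lambda>i2. of_real (real (a choose i) * real (n choose i2) / real (N choose b)) * ?e i"
    have "(\<Sum>i2\<le>n. if i + i2 = b then ?g i2 else 0) =
      (\<Sum>i2\<le>n. if i2 = b - i then if i \<le> b then ?g i2 else 0 else 0)"
      by (intro sum.cong) auto
    also have "\<dots> = ?r i" by simp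
    finally show "(\<Sum>i2\<le>n. if i + i2 = b then ?g i2 else 0) = ?r i" .
  qed
  finally have Phi: "Phi0 (real N / 2) (a_elt t) (real a - real N / 2) (real b - real N / 2) =
    (\<Sum>i\<le>a. ?r i)" .
  \<comment> \<open>Outside the range \<open>i \<le> b \<le> n + i\<close> a binomial coefficient on the right vanishes, so the two
    sums over \<open>i \<le> a\<close> agree term by term.\<close>
  have "of_nat (N choose a) * ?r i = cis ((real b - real N / 2) * t) *
     (coeff ([:1, cis (- t):] ^ b) i * coeff ([:1, cis t:] ^ (N - b)) (a - i))" if "i \<le> a" for i
  proof (cases "i \<le> b \<and> b - i \<le> n")
    case True
    have sym: "complex_of_nat (N choose a) * of_real (real (a choose i) * real (n choose (b - i)) / real (N choose b)) =
      of_nat (b choose i) * of_nat ((N - b) choose (a - i))"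
      using arg_cong[OF hypergeometric_symmetry[of i a b n], of complex_of_real] True that by (simp add: N)
    have e: "?e i = cis ((real b - real N / 2) * t) * (cis (- t) ^ i * cis t ^ (a - i))"
      unfolding Complex.DeMoivre cis_mult using that by (simp add: of_nat_diff algebra_simps)
    have "of_nat (N choose a) * ?r i = of_nat (N choose a) *
        of_real (real (a choose i) * real (n choose (b - i)) / real (N choose b)) * ?e i"
      using True by (simp only: simp_thms if_True mult.assoc)
    then show ?thesis
      unfolding sym e coeff_one_linear_power by (simp only: mult_ac)
  next
    case False
    then have "b choose i = 0 \<or> (N - b) choose (a - i) = 0"
      using that assms by (auto simp: N)
    with False show ?thesis by (auto simp: coeff_one_linear_power)
  qed
  then show ?thesis
    unfolding Phi coeff_mult sum_distrib_left by (intro sum.cong) auto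
qed

section \<open>Summation of the geometric series\<close>

text \<open>The coefficient of \<open>w\<^sup>a v\<^sup>d\<close> in
  \<open>\<Sum>\<^sub>b ((1 + x w) (1 + y v))\<^sup>b ((1 + y w) (1 + x v))\<^bsup>N - b\<^esup>\<close>. Two univariate polynomials
  suffice because every summand is a product of a polynomial in \<open>w\<close> and one in \<open>v\<close>.\<close>

definition pairing :: "nat \<Rightarrow> 'a::comm_ring_1 \<Rightarrow> 'a \<Rightarrow> nat \<Rightarrow> nat \<Rightarrow> 'a" where
  "pairing N x y a d = (\<Sum>b\<le>N. coeff ([:1, x:] ^ b * [:1, y:] ^ (N - b)) a *
     coeff ([:1, y:] ^ b * [:1, x:] ^ (N - b)) d)"

lemma coeff_linear_mult: "coeff ([:1, x:] * P) k = coeff P k + x * coeff (pCons 0 P) k"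
  for x :: "'a::comm_ring_1"
  by (simp add: coeff_pCons split: nat.split)

text \<open>This is the coefficient at \<open>w\<^bsup>a + 1\<^esup> v\<^sup>d\<close> of
  \<open>(B - A) \<Sum>\<^sub>b A\<^sup>b B\<^bsup>N - b\<^esup> = B\<^bsup>N + 1\<^esup> - A\<^bsup>N + 1\<^esup>\<close>, where
  \<open>A = (1 + x w) (1 + y v)\<close>, \<open>B = (1 + y w) (1 + x v)\<close> and \<open>B - A = (y - x) (w - v)\<close>. The factor
  \<open>w\<close> contributes the coefficient at \<open>(a, d)\<close>, the factor \<open>v\<close> the one at \<open>(a + 1, d - 1)\<close>.\<close>

lemma pairing_telescope:
  fixes x y :: "'a::comm_ring_1"
  shows "(y - x) * (pairing N x y a d - (case d of 0 \<Rightarrow> 0 | Suc e \<Rightarrow> pairing N x y (Suc a) e)) =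
    of_nat (Suc N choose Suc a) * of_nat (Suc N choose d) * (y ^ Suc a * x ^ d - x ^ Suc a * y ^ d)"
proof -
  \<comment> \<open>\<open>T b\<close> is the coefficient at \<open>w\<^bsup>a + 1\<^esup> v\<^sup>d\<close> of \<open>A\<^sup>b B\<^bsup>N + 1 - b\<^esup>\<close>, so that the
    geometric sum telescopes.\<close>
  define P where "P b = [:1, x:] ^ b * [:1, y:] ^ (N - b)" for b
  define Q where "Q b = [:1, y:] ^ b * [:1, x:] ^ (N - b)" for b
  define T where "T b = coeff ([:1, x:] ^ b * [:1, y:] ^ (Suc N - b)) (Suc a) *
    coeff ([:1, y:] ^ b * [:1, x:] ^ (Suc N - b)) d" for b
  have shift: "(case d of 0 \<Rightarrow> 0 | Suc e \<Rightarrow> pairing N x y (Suc a) e) =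
    (\<Sum>b\<le>N. coeff (P b) (Suc a) * coeff (pCons 0 (Q b)) d)"
    by (auto simp: pairing_def P_def Q_def split: nat.split)
  have step: "T b - T (Suc b) =
    (y - x) * (coeff (P b) a * coeff (Q b) d - coeff (P b) (Suc a) * coeff (pCons 0 (Q b)) d)"
    if "b < Suc N" for b
  proof -
    have 1: "[:1, x:] ^ b * [:1, y:] ^ (Suc N - b) = [:1, y:] * P b"
      "[:1, y:] ^ b * [:1, x:] ^ (Suc N - b) = [:1, x:] * Q b"
      using that by (simp_all only: P_def Q_def Suc_diff_le power_Suc mult_ac less_Suc_eq_le)
    have 2: "[:1, x:] ^ Suc b * [:1, y:] ^ (Suc N - Suc b) = [:1, x:] * P b"
      "[:1, y:] ^ Suc b * [:1, x:] ^ (Suc N - Suc b) = [:1, y:] * Q b"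
      by (simp_all only: P_def Q_def diff_Suc_Suc power_Suc mult_ac)
    show ?thesis
      unfolding T_def 1 2 coeff_linear_mult coeff_pCons_Suc by (simp only: algebra_simps)
  qed
  have "(y - x) * (pairing N x y a d - (case d of 0 \<Rightarrow> 0 | Suc e \<Rightarrow> pairing N x y (Suc a) e)) =
    (\<Sum>b<Suc N. T b - T (Suc b))"
    unfolding shift by (simp add: pairing_def step sum_distrib_left sum_subtractf
        right_diff_distrib lessThan_Suc_atMost flip: P_def Q_def)
  also have "\<dots> = T 0 - T (Suc N)" by (rule sum_lessThan_telescope')
  also have "\<dots> = of_nat (Suc N choose Suc a) * of_nat (Suc N choose d) *
      (y ^ Suc a * x ^ d - x ^ Suc a * y ^ d)"
    by (simp only: T_def coeff_one_linear_power power_0 mult_1_left mult_1_right power_one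
        diff_zero diff_self_eq_0) (simp only: algebra_simps)
  finally show ?thesis .
qed

lemma chebyshev_U_sin: "sin t * poly (chebyshev_U n) (cos t) = sin (real (n + 1) * t)"
proof (induction n rule: chebyshev_U.induct)
  case 1 then show ?case by simp
next
  case 2 then show ?case by (simp add: sin_double)
next
  case (3 n)
  have "sin (real (n + 2) * t + t) + sin (real (n + 2) * t - t) = 2 * sin (real (n + 2) * t) * cos t"
    by (simp only: sin_add sin_diff)
  with 3 show ?case by (simp add: algebra_simps)
qed

text \<open>At \<open>x = e\<^bsup>-i t\<^esup>\<close>, \<open>y = e\<^bsup>i t\<^esup>\<close> the telescoping identity divided by
  \<open>y - x = 2 i sin t\<close> turns its right-hand side into a multiple of \<open>U\<^bsub>a - d\<^esub>(cos t)\<close>. Each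
  step from \<open>(a, d)\<close> to \<open>(a + 1, d - 1)\<close> keeps \<open>a + d\<close>, which is why the degrees
  \<open>a + d - 2 n\<close> go down in steps of two.\<close>

lemma pairing_chebyshev:
  assumes "sin t \<noteq> 0" "d \<le> a"
  shows "pairing N (cis (- t)) (cis t) a d = of_real (\<Sum>n\<le>d.
    real (Suc N choose (a + d + 1 - n)) * real (Suc N choose n) *
    poly (chebyshev_U (a + d - 2 * n)) (cos t))"
proof -
  have step: "pairing N (cis (- t)) (cis t) a d =
      (case d of 0 \<Rightarrow> 0 | Suc e \<Rightarrow> pairing N (cis (- t)) (cis t) (Suc a) e) +
      of_real (real (Suc N choose Suc a) * real (Suc N choose d) *
        poly (chebyshev_U (a - d)) (cos t))" (is "?X = ?Y + of_real (?B * ?C * ?U)")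
    if "d \<le> a" for a d
  proof -
    have im: "cis u - cis (- u) = 2 * \<i> * of_real (sin u)" for u
      by (simp add: complex_eq_iff)
    have "cis t ^ Suc a * cis (- t) ^ d - cis (- t) ^ Suc a * cis t ^ d =
      cis (real (a - d + 1) * t) - cis (- (real (a - d + 1) * t))"
      unfolding Complex.DeMoivre cis_mult using that by (simp add: of_nat_diff algebra_simps)
    also have "\<dots> = 2 * \<i> * of_real (sin t) * of_real ?U"
      unfolding im chebyshev_U_sin[symmetric] by simp
    finally have "2 * \<i> * of_real (sin t) * (?X - ?Y) =
      2 * \<i> * of_real (sin t) * of_real (?B * ?C * ?U)"
      using pairing_telescope[of "cis t" "cis (- t)" N a d] unfolding im by (simp add: mult_ac)
    with assms(1) have "?X - ?Y = of_real (?B * ?C * ?U)" by simp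
    then show ?thesis by (simp only: diff_eq_eq add.commute)
  qed
  show ?thesis using assms(2)
  proof (induction d arbitrary: a)
    case (0 a)
    show ?case using step[of 0 a] by simp
  next
    case (Suc d a)
    have "a + Suc d - 2 * Suc d = a - Suc d" "a + Suc d + 1 - Suc d = Suc a" by auto
    then show ?case
      using step[of "Suc d" a] Suc by simp
  qed
qed

text \<open>The phases \<open>e\<^bsup>i (b - N/2) t\<^esup>\<close> of the two factors cancel.\<close>

lemma weight_V_half:
  assumes "a \<le> N" "d \<le> N"
  shows "of_nat (N choose a) * of_nat (N choose d) *
      weight_V (real N / 2) t (real a - real N / 2) (real d - real N / 2) =
    pairing N (cis (- t)) (cis t) a d * of_real ((sin t)\<^sup>2)"
proof -
  let ?P = "\<lambda>a b. Phi0 (real N / 2) (a_elt t) (real a - real N / 2) (real b - real N / 2)"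
  have "of_nat (N choose a) * ?P a b * cnj (of_nat (N choose d) * ?P d b) =
    coeff ([:1, cis (- t):] ^ b * [:1, cis t:] ^ (N - b)) a *
    coeff ([:1, cis t:] ^ b * [:1, cis (- t):] ^ (N - b)) d" if b: "b \<le> N" for b
  proof -
    have "cnj (coeff ([:1, cis (- t):] ^ b * [:1, cis t:] ^ (N - b)) d) =
      coeff ([:1, cis t:] ^ b * [:1, cis (- t):] ^ (N - b)) d"
      by (simp add: coeff_mult coeff_one_linear_power cis_cnj)
    moreover have "cis s * cnj (cis s) = 1" for s by (simp add: cis_cnj cis_mult)
    ultimately show ?thesis
      unfolding Phi0_generating_function[OF assms(1) b] Phi0_generating_function[OF assms(2) b]
      by (simp add: mult_ac)
  qed
  then show ?thesis
    unfolding weight_V_def sum_weights_half pairing_def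
    by (simp add: sum_distrib_left sum_distrib_right mult_ac)
qed

section \<open>The coefficients\<close>

lemma pochhammer_nat_fact: "pochhammer (real (Suc m)) k = fact (m + k) / fact m"
  using pochhammer_product'[of "1::real" m k] by (simp add: add.commute flip: pochhammer_fact)

text \<open>The sign \<open>(- 1)\<^bsup>d - n\<^esup>\<close> turns the Pochhammer symbol at the
  nonpositive argument \<open>a - N\<close> into one at a positive integer, after which all factors are
  quotients of factorials. The bound \<open>a + d \<le> N\<close> ensures \<open>d - n \<le> N - a\<close>, so that this Pochhammer symbol
  does not reach zero.\<close>

lemma coefficient_eq_binomials:
  fixes N a d n :: nat
  assumes "d \<le> a" "a + d \<le> N" "n \<le> d"
  shows "(real N + 1) / (real a + 1) * (fact (N - d) * fact d / fact N) *
      (pochhammer (real a - real N) (d - n) / pochhammer (real a + 2) (d - n)) * (- 1) ^ (d - n) *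
      (pochhammer (real N + 2 - real n) n / fact n) =
    real (Suc N choose (a + d + 1 - n)) * real (Suc N choose n) / (real (N choose a) * real (N choose d))"
proof -
  define k where "k = d - n"
  define r where "r = N - a - k"
  have N: "N = a + k + r" and d: "d = n + k" using assms by (auto simp: k_def r_def)
  have "real a - real N = - real (k + r)" by (simp add: N)
  then have "pochhammer (real a - real N) k * (- 1) ^ k = pochhammer (real (k + r) - real k + 1) k"
    by (simp only: pochhammer_minus) (simp flip: power_mult_distrib)
  also have "\<dots> = pochhammer (real (Suc r)) k" by (simp add: add_ac)
  finally have 1: "pochhammer (real a - real N) k * (- 1) ^ k = fact (r + k) / fact r"
    by (simp only: pochhammer_nat_fact)
  have "real a + 2 = real (Suc (a + 1))" by simp
  then have 2: "pochhammer (real a + 2) k = fact (a + 1 + k) / fact (a + 1)"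
    by (simp only: pochhammer_nat_fact)
  have "real N + 2 - real n = real (Suc (Suc N - n))" using assms by (simp add: of_nat_diff)
  then have 3: "pochhammer (real N + 2 - real n) n = fact (Suc N) / fact (Suc N - n)"
    using assms by (simp only: pochhammer_nat_fact) simp
  have b: "real (Suc N choose (a + d + 1 - n)) = fact (Suc N) / (fact (a + 1 + k) * fact r)"
    "real (Suc N choose n) = fact (Suc N) / (fact n * fact (Suc N - n))"
    "real (N choose a) = fact N / (fact a * fact (r + k))"
    "real (N choose d) = fact N / (fact d * fact (N - d))"
    using assms binomial_fact[of "a + 1 + k" "Suc N", where 'a = real]
      binomial_fact[of n "Suc N", where 'a = real]
      binomial_fact[of a N, where 'a = real] binomial_fact[of d N, where 'a = real]
    by (simp_all add: N d add_ac)
  have "(real N + 1) / (real a + 1) * (fact (N - d) * fact d / fact N) *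
      (pochhammer (real a - real N) k / pochhammer (real a + 2) k) * (- 1) ^ k *
      (pochhammer (real N + 2 - real n) n / fact n) =
    (real N + 1) / (real a + 1) * (fact (N - d) * fact d / fact N) *
      ((pochhammer (real a - real N) k * (- 1) ^ k) / pochhammer (real a + 2) k) *
      (pochhammer (real N + 2 - real n) n / fact n)" by simp
  also have "\<dots> = (fact (Suc N) / fact N) * (fact (N - d) * fact d / fact N) *
      (fact (r + k) * fact a / (fact r * fact (a + 1 + k))) *
      (fact (Suc N) / (fact (Suc N - n) * fact n))"
    unfolding 1 2 3 by (simp add: divide_simps add.commute)
  also have "\<dots> = real (Suc N choose (a + d + 1 - n)) * real (Suc N choose n) /
      (real (N choose a) * real (N choose d))"
    unfolding b by (simp add: divide_simps)
  finally show ?thesis unfolding k_def .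
qed

theorem theorem5p4:
  fixes l p q :: real
  assumes "2 * l \<in> \<nat>"
    and "p \<in> weights l" and "q \<in> weights l"
    and "q - p \<le> 0" and "q + p \<le> 0"
  shows "\<exists>c :: nat \<Rightarrow> real.
    (\<forall>n \<le> nat \<lfloor>l + q\<rfloor>. c n \<in> \<rat> \<and> c n > 0) \<and>
    (\<forall>t :: real. weight_V l t p q =
       of_real ((sin t)\<^sup>2 * (\<Sum>n = 0..nat \<lfloor>l + q\<rfloor>.
         c n * poly (chebyshev_U (nat \<lfloor>2 * l + p + q - 2 * real n\<rfloor>)) (cos t)))) \<and>
    (\<forall>n \<le> nat \<lfloor>l + q\<rfloor>. c n =
       (2 * l + 1) / (l + p + 1)
       * (rfact (l - q) * rfact (l + q) / rfact (2 * l))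
       * (pochhammer (p - l) (nat \<lfloor>l + q\<rfloor> - n) / pochhammer (l + p + 2) (nat \<lfloor>l + q\<rfloor> - n))
       * (- 1) ^ (nat \<lfloor>l + q\<rfloor> - n)
       * (pochhammer (2 * l + 2 - real n) n / fact n))"
proof -
  obtain N where N: "2 * l = real N" using assms(1) by (auto elim: Nats_cases)
  then have l: "l = real N / 2" by simp
  obtain a where a: "a \<le> N" "p = real a - real N / 2"
    using assms(2) by (auto simp: l weights_half)
  obtain d where d: "d \<le> N" "q = real d - real N / 2"
    using assms(3) by (auto simp: l weights_half)
  have da: "d \<le> a" using assms(4) by (simp add: a d)
  have adN: "a + d \<le> N" using assms(5) by (simp add: a d)
  have lq: "l + q = real d" "nat \<lfloor>l + q\<rfloor> = d" and lp: "l + p = real a" "p - l = real a - real N"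
    and lmq: "l - q = real (N - d)"
    using d(1) by (simp_all add: l a d)
  have fact: "rfact (l - q) * rfact (l + q) / rfact (real N) = fact (N - d) * fact d / fact N"
    by (simp only: lq lmq rfact_def floor_of_nat nat_int)
  define c where "c n = real (Suc N choose (a + d + 1 - n)) * real (Suc N choose n) /
    (real (N choose a) * real (N choose d))" for n
  have "c n \<in> \<rat> \<and> c n > 0" if "n \<le> d" for n
    using that a(1) d(1) adN unfolding c_def by (auto intro!: divide_pos_pos mult_pos_pos)
  moreover have "weight_V l t p q = of_real ((sin t)\<^sup>2 * (\<Sum>n = 0..d.
         c n * poly (chebyshev_U (nat \<lfloor>2 * l + p + q - 2 * real n\<rfloor>)) (cos t)))" for t
  \<comment> \<open>At the zeros of \<open>sin t\<close>, where the division by \<open>z - 1/z\<close> is not possible, both sides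
    vanish because of the factor \<open>sin\<^sup>2 t\<close>.\<close>
  proof (cases "sin t = 0")
    case True
    then show ?thesis by (simp add: weight_V_def)
  next
    case False
    have deg: "nat \<lfloor>2 * l + p + q - 2 * real n\<rfloor> = a + d - 2 * n" if "n \<le> d" for n
    proof -
      have "2 * l + p + q - 2 * real n = real (a + d - 2 * n)"
        using that da by (simp add: l a d of_nat_diff)
      then show ?thesis by (simp only: floor_of_nat nat_int)
    qed
    have nz: "N choose a \<noteq> 0" "N choose d \<noteq> 0" using a(1) d(1) by auto
    have "complex_of_real (real (N choose a) * real (N choose d)) * weight_V l t p q =
      of_real ((sin t)\<^sup>2 * (\<Sum>n\<le>d. real (Suc N choose (a + d + 1 - n)) * real (Suc N choose n) *
        poly (chebyshev_U (a + d - 2 * n)) (cos t)))"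
      using weight_V_half[OF a(1) d(1), of t] pairing_chebyshev[OF False da, of N]
      by (simp add: l a d mult_ac)
    also have "(\<Sum>n\<le>d. real (Suc N choose (a + d + 1 - n)) * real (Suc N choose n) *
        poly (chebyshev_U (a + d - 2 * n)) (cos t)) =
      (real (N choose a) * real (N choose d)) * (\<Sum>n = 0..d.
         c n * poly (chebyshev_U (nat \<lfloor>2 * l + p + q - 2 * real n\<rfloor>)) (cos t))"
      unfolding sum_distrib_left atMost_atLeast0 using nz
      by (intro sum.cong) (simp_all add: deg c_def)
    finally show ?thesis using nz by simp
  qed
  moreover have "c n = (2 * l + 1) / (l + p + 1)
       * (rfact (l - q) * rfact (l + q) / rfact (2 * l))
       * (pochhammer (p - l) (d - n) / pochhammer (l + p + 2) (d - n))
       * (- 1) ^ (d - n)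
       * (pochhammer (2 * l + 2 - real n) n / fact n)" if "n \<le> d" for n
    unfolding fact lp N coefficient_eq_binomials[OF da adN that] c_def ..
  ultimately show ?thesis unfolding lq(2) by (intro exI[of _ c]) blast
qed

end
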